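(* Let $T>0$, $\sigma>0$, $\rho\in(-1,1)$, $\kappa,x,r\in\mathbb{R}$. Let $(X_s,r_s)_{s\in[0,T]}$ be the solution, under $Q$, of $$X_s = x+\int_0^s\Big(r_v-\frac{\sigma^2}{2}\Big)dv+\sigma\big[\rho B^1_s+\sqrt{1-\rho^2}\,B^2_s\big],\qquad r_s=r+\int_0^s\mu(v,r_v)\,dv+\int_0^s\eta(v,r_v)\,dB^1_v,$$ under the standing assumptions given in the context, and set $\Lambda_T=\int_0^T r_s\,ds$. Then the call price $$u(x,r,T;\rho)=\mathbb{E}\Big(e^{-\Lambda_T}\big(e^{X_T}-e^{\kappa}\big)^+\Big)$$ satisfies $$u(x,r,T;\rho)=e^{x}e^{-\frac{\sigma^2\rho^2}{2}T}\,\mathbb{E}\Big(e^{\sigma\rho B^1_T}\,\mathcal{N}(d_1(\rho))\Big)-e^{\kappa}\,\mathbb{E}\Big(e^{-\Lambda_T}\,\mathcal{N}(d_2(\rho))\Big),$$ where $$d_1(\rho)=\frac{x-\kappa+\Lambda_T+\sigma\rho B^1_T+\frac{\sigma^2}{2}T-\sigma^2\rho^2T}{\sigma\sqrt{1-\rho^2}\sqrt{T}},\qquad d_2(\rho)=\frac{x-\kappa+\Lambda_T+\sigma\rho B^1_T-\frac{\sigma^2}{2}T}{\sigma\sqrt{1-\rho^2}\sqrt{T}}.$$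
   Context: $(\Omega,\mathcal{F},Q)$ is a complete probability space with a filtration $(\mathcal{F}_t)_{t\in[0,T]}$ satisfying the usual hypotheses, $\mathbb{E}$ is expectation under $Q$, and $(B^1,B^2)$ is a two-dimensional standard $(\mathcal{F}_t)$-Brownian motion (started at $0$). The deterministic functions $\mu,\eta$ are such that the system of stochastic differential equations for $(X,r)$ has a unique strong solution (so in particular $r$ is adapted to the completed filtration generated by $B^1$), and such that $X_T$ and $\int_0^T|r_s|\,ds$ are exponentially integrable, i.e. $\mathbb{E}(e^{X_T})<\infty$ and $\mathbb{E}(e^{\int_0^T|r_s|ds})<\infty$. $\mathcal{N}$ denotes the cumulative distribution function of the standard Gaussian law, and $y^+=\max(y,0)$. *)

theory Defs
  imports "HOL-Probability.Probability"
begin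

section \<open>Filtered probability spaces\<close>

text \<open>Time runs through \<^term>\<open>{0..T}\<close>; values of filtrations and processes at other real
  arguments are irrelevant.\<close>

locale filtered_prob_space = prob_space M + complete_measure M
  for M :: "'a measure" +
  fixes F :: "real \<Rightarrow> 'a measure" and T :: real
  assumes subalgebra_F: "t \<in> {0..T} \<Longrightarrow> subalgebra M (F t)"
    and F_mono: "0 \<le> s \<Longrightarrow> s \<le> t \<Longrightarrow> t \<le> T \<Longrightarrow> sets (F s) \<subseteq> sets (F t)"
    and null_sets_F0: "null_sets M \<subseteq> sets (F 0)"
    and F_right_cont: "t \<in> {0..<T} \<Longrightarrow> sets (F t) = (\<Inter>u\<in>{t<..T}. sets (F u))"

definition adapted ::
  "(real \<Rightarrow> 'a measure) \<Rightarrow> real \<Rightarrow> (real \<Rightarrow> 'a \<Rightarrow> 'b::topological_space) \<Rightarrow> bool" where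
  "adapted F T Y \<longleftrightarrow> (\<forall>t\<in>{0..T}. Y t \<in> borel_measurable (F t))"

definition prog_measurable ::
  "(real \<Rightarrow> 'a measure) \<Rightarrow> real \<Rightarrow> (real \<Rightarrow> 'a \<Rightarrow> real) \<Rightarrow> bool" where
  "prog_measurable F T H \<longleftrightarrow>
     (\<forall>t\<in>{0..T}. (\<lambda>(s, \<omega>). H s \<omega>) \<in> borel_measurable (restrict_space borel {0..t} \<Otimes>\<^sub>M F t))"

definition continuous_paths ::
  "'a measure \<Rightarrow> real \<Rightarrow> (real \<Rightarrow> 'a \<Rightarrow> 'b::topological_space) \<Rightarrow> bool" where
  "continuous_paths M T Y \<longleftrightarrow> (AE \<omega> in M. continuous_on {0..T} (\<lambda>t. Y t \<omega>))"

text \<open>The filtration generated by a process, completed by the null sets of \<^term>\<open>M\<close>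
  (which are all negligible sets, as \<^term>\<open>M\<close> is complete in all uses).\<close>

definition completed_filtration ::
  "'a measure \<Rightarrow> (real \<Rightarrow> 'a \<Rightarrow> 'b::topological_space) \<Rightarrow> real \<Rightarrow> 'a measure" where
  "completed_filtration M Y t =
     sigma (space M) ({Y s -` A \<inter> space M | s A. s \<in> {0..t} \<and> A \<in> sets borel} \<union> null_sets M)"


section \<open>Brownian motion\<close>

definition brownian_motion ::
  "'a measure \<Rightarrow> (real \<Rightarrow> 'a measure) \<Rightarrow> real \<Rightarrow> (real \<Rightarrow> 'a \<Rightarrow> real ^ 'd) \<Rightarrow> bool" where
  "brownian_motion M F T B \<longleftrightarrow>
     adapted F T B \<and> continuous_paths M T B \<and> (AE \<omega> in M. B 0 \<omega> = 0) \<and>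
     (\<forall>s t. 0 \<le> s \<longrightarrow> s < t \<longrightarrow> t \<le> T \<longrightarrow>
        prob_space.indep_set M (sets (F s))
          {(\<lambda>\<omega>. B t \<omega> - B s \<omega>) -` A \<inter> space M | A. A \<in> sets borel} \<and>
        prob_space.indep_vars M (\<lambda>_. borel) (\<lambda>i \<omega>. B t \<omega> $ i - B s \<omega> $ i) UNIV \<and>
        (\<forall>i. distributed M lborel (\<lambda>\<omega>. B t \<omega> $ i - B s \<omega> $ i) (normal_density 0 (sqrt (t - s)))))"


section \<open>The Ito integral\<close>

definition tendsto_zero_in_prob :: "'a measure \<Rightarrow> (nat \<Rightarrow> 'a \<Rightarrow> real) \<Rightarrow> bool" where
  "tendsto_zero_in_prob M Z \<longleftrightarrow>
     (\<forall>\<epsilon>>0. (\<lambda>m. measure M {\<omega> \<in> space M. \<bar>Z m \<omega>\<bar> > \<epsilon>}) \<longlonglongrightarrow> 0)"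

text \<open>A simple process is determined by a number \<^term>\<open>k\<close> of intervals, grid points
  \<open>p 0 \<le> \<dots> \<le> p k\<close> and bounded heights \<^term>\<open>\<xi> i\<close>, known at time \<^term>\<open>p i\<close>.\<close>

definition simple_data ::
  "'a measure \<Rightarrow> (real \<Rightarrow> 'a measure) \<Rightarrow> real \<Rightarrow> nat \<Rightarrow> (nat \<Rightarrow> real) \<Rightarrow> (nat \<Rightarrow> 'a \<Rightarrow> real) \<Rightarrow> bool" where
  "simple_data M F T k p \<xi> \<longleftrightarrow>
     0 \<le> p 0 \<and> (\<forall>i<k. p i \<le> p (Suc i)) \<and> p k \<le> T \<and>
     (\<forall>i<k. \<xi> i \<in> borel_measurable (F (p i)) \<and> (\<exists>C. \<forall>\<omega>\<in>space M. \<bar>\<xi> i \<omega>\<bar> \<le> C))"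

definition simple_process ::
  "nat \<Rightarrow> (nat \<Rightarrow> real) \<Rightarrow> (nat \<Rightarrow> 'a \<Rightarrow> real) \<Rightarrow> real \<Rightarrow> 'a \<Rightarrow> real" where
  "simple_process k p \<xi> t \<omega> = (\<Sum>i<k. \<xi> i \<omega> * indicator {p i<..p (Suc i)} t)"

definition simple_integral ::
  "(real \<Rightarrow> 'a \<Rightarrow> real) \<Rightarrow> nat \<Rightarrow> (nat \<Rightarrow> real) \<Rightarrow> (nat \<Rightarrow> 'a \<Rightarrow> real) \<Rightarrow> real \<Rightarrow> 'a \<Rightarrow> real" where
  "simple_integral W k p \<xi> t \<omega> = (\<Sum>i<k. \<xi> i \<omega> * (W (min t (p (Suc i))) \<omega> - W (min t (p i)) \<omega>))"

text \<open>\<^term>\<open>I\<close> is (a version of) the process of Ito integrals of \<^term>\<open>H\<close> over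
  \<^term>\<open>{0..t}\<close> with respect to the Brownian motion \<^term>\<open>W\<close>: the limit, uniformly on
  \<^term>\<open>{0..T}\<close> in probability, of the integrals of simple processes that approximate
  \<^term>\<open>H\<close> in the \<open>L\<^sup>2\<close> norm in time, in probability.\<close>

definition ito_integral ::
  "'a measure \<Rightarrow> (real \<Rightarrow> 'a measure) \<Rightarrow> real \<Rightarrow> (real \<Rightarrow> 'a \<Rightarrow> real) \<Rightarrow>
   (real \<Rightarrow> 'a \<Rightarrow> real) \<Rightarrow> (real \<Rightarrow> 'a \<Rightarrow> real) \<Rightarrow> bool" where
  "ito_integral M F T W H I \<longleftrightarrow>
     prog_measurable F T H \<and>
     (AE \<omega> in M. set_integrable lborel {0..T} (\<lambda>s. (H s \<omega>)\<^sup>2)) \<and>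
     adapted F T I \<and> continuous_paths M T I \<and>
     (\<exists>k p \<xi>. (\<forall>m. simple_data M F T (k m) (p m) (\<xi> m)) \<and>
        tendsto_zero_in_prob M
          (\<lambda>m \<omega>. LINT s:{0..T}|lborel. (simple_process (k m) (p m) (\<xi> m) s \<omega> - H s \<omega>)\<^sup>2) \<and>
        tendsto_zero_in_prob M
          (\<lambda>m \<omega>. SUP t\<in>{0..T}. \<bar>simple_integral W (k m) (p m) (\<xi> m) t \<omega> - I t \<omega>\<bar>))"


section \<open>The model\<close>

text \<open>\<^term>\<open>B t \<omega> $ 1\<close> and \<^term>\<open>B t \<omega> $ 2\<close> are the two components of the driving noise.
  The equation for the rate is autonomous and driven by the first one only, so that
  a strong solution has its rate adapted to the completed filtration of that component.\<close>

definition strong_solution ::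
  "'a measure \<Rightarrow> (real \<Rightarrow> 'a measure) \<Rightarrow> real \<Rightarrow> (real \<Rightarrow> 'a \<Rightarrow> real ^ 2) \<Rightarrow>
   (real \<Rightarrow> real \<Rightarrow> real) \<Rightarrow> (real \<Rightarrow> real \<Rightarrow> real) \<Rightarrow> real \<Rightarrow> real \<Rightarrow> real \<Rightarrow> real \<Rightarrow>
   (real \<Rightarrow> 'a \<Rightarrow> real) \<Rightarrow> (real \<Rightarrow> 'a \<Rightarrow> real) \<Rightarrow> bool" where
  "strong_solution M F T B \<mu> \<eta> \<sigma> \<rho> x\<^sub>0 r\<^sub>0 X r \<longleftrightarrow>
     continuous_paths M T X \<and> continuous_paths M T r \<and>
     adapted (completed_filtration M B) T X \<and>
     adapted (completed_filtration M (\<lambda>t \<omega>. B t \<omega> $ 1)) T r \<and>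
     (AE \<omega> in M. \<forall>s\<in>{0..T}.
        X s \<omega> = x\<^sub>0 + (LINT v:{0..s}|lborel. r v \<omega> - \<sigma>\<^sup>2 / 2)
          + \<sigma> * (\<rho> * B s \<omega> $ 1 + sqrt (1 - \<rho>\<^sup>2) * B s \<omega> $ 2)) \<and>
     prog_measurable F T (\<lambda>v \<omega>. \<mu> v (r v \<omega>)) \<and>
     (AE \<omega> in M. set_integrable lborel {0..T} (\<lambda>v. \<mu> v (r v \<omega>))) \<and>
     (\<exists>I. ito_integral M F T (\<lambda>t \<omega>. B t \<omega> $ 1) (\<lambda>v \<omega>. \<eta> v (r v \<omega>)) I \<and>
        (AE \<omega> in M. \<forall>s\<in>{0..T}.
           r s \<omega> = r\<^sub>0 + (LINT v:{0..s}|lborel. \<mu> v (r v \<omega>)) + I s \<omega>))"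

definition unique_strong_solution ::
  "'a measure \<Rightarrow> (real \<Rightarrow> 'a measure) \<Rightarrow> real \<Rightarrow> (real \<Rightarrow> 'a \<Rightarrow> real ^ 2) \<Rightarrow>
   (real \<Rightarrow> real \<Rightarrow> real) \<Rightarrow> (real \<Rightarrow> real \<Rightarrow> real) \<Rightarrow> real \<Rightarrow> real \<Rightarrow> real \<Rightarrow> real \<Rightarrow>
   (real \<Rightarrow> 'a \<Rightarrow> real) \<Rightarrow> (real \<Rightarrow> 'a \<Rightarrow> real) \<Rightarrow> bool" where
  "unique_strong_solution M F T B \<mu> \<eta> \<sigma> \<rho> x\<^sub>0 r\<^sub>0 X r \<longleftrightarrow>
     strong_solution M F T B \<mu> \<eta> \<sigma> \<rho> x\<^sub>0 r\<^sub>0 X r \<and>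
     (\<forall>X' r'. strong_solution M F T B \<mu> \<eta> \<sigma> \<rho> x\<^sub>0 r\<^sub>0 X' r' \<longrightarrow>
        (AE \<omega> in M. \<forall>t\<in>{0..T}. X' t \<omega> = X t \<omega> \<and> r' t \<omega> = r t \<omega>))"

definition integrated_rate :: "real \<Rightarrow> (real \<Rightarrow> 'a \<Rightarrow> real) \<Rightarrow> 'a \<Rightarrow> real" where
  "integrated_rate T r \<omega> = (LINT s:{0..T}|lborel. r s \<omega>)"

definition call_price ::
  "'a measure \<Rightarrow> real \<Rightarrow> real \<Rightarrow> (real \<Rightarrow> 'a \<Rightarrow> real) \<Rightarrow> (real \<Rightarrow> 'a \<Rightarrow> real) \<Rightarrow> real" where
  "call_price M T \<kappa> X r =
     (LINT \<omega>|M. exp (- integrated_rate T r \<omega>) * max (exp (X T \<omega>) - exp \<kappa>) 0)"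

text \<open>\<^term>\<open>l\<close> and \<^term>\<open>b\<close> stand for the values of the integrated rate and of the first
  Brownian component at time \<^term>\<open>T\<close>.\<close>

definition d1 :: "real \<Rightarrow> real \<Rightarrow> real \<Rightarrow> real \<Rightarrow> real \<Rightarrow> real \<Rightarrow> real \<Rightarrow> real" where
  "d1 \<sigma> \<rho> \<kappa> x T l b =
     (x - \<kappa> + l + \<sigma> * \<rho> * b + \<sigma>\<^sup>2 / 2 * T - \<sigma>\<^sup>2 * \<rho>\<^sup>2 * T) / (\<sigma> * sqrt (1 - \<rho>\<^sup>2) * sqrt T)"

definition d2 :: "real \<Rightarrow> real \<Rightarrow> real \<Rightarrow> real \<Rightarrow> real \<Rightarrow> real \<Rightarrow> real \<Rightarrow> real" where
  "d2 \<sigma> \<rho> \<kappa> x T l b =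
     (x - \<kappa> + l + \<sigma> * \<rho> * b - \<sigma>\<^sup>2 / 2 * T) / (\<sigma> * sqrt (1 - \<rho>\<^sup>2) * sqrt T)"

end

theory Submission
  imports Defs
begin

text \<open>Given the path of $B^1$, the random variable $X_T$ is Gaussian: $\Lambda_T$ and $B^1_T$ are
  measurable with respect to the completed sigma-algebra of $B^1$, from which $B^2_T$ is
  independent. Integrating out $B^2_T$ first is therefore the Black--Scholes computation with
  volatility $\sigma\sqrt{1-\rho^2}$ and strike $e^{\kappa-\Lambda_T}$.

  Independence is not part of the definition of a Brownian motion, which only speaks of the
  components of a single increment. It follows by induction along finite time grids, since each
  increment is independent of the past, and a monotone class argument.\<close>

section \<open>Sigma-algebras generated by a process\<close>

text \<open>Two nuisances shape the proof. The sigma-algebra of the first component has to contain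
  all null sets, since the rate is adapted to the completed filtration. They enter in the base case
  of the induction, where the sigma-algebra of time 0 has only events of probability 0 or 1, and are
  then carried along. Moreover, the paths of the rate are continuous only almost surely, so the
  integrated rate is replaced by a version that is a measurable function of the rate at countably
  many times.

  The induction treats the components asymmetrically: it keeps the first one on the whole grid but
  the second one only at the last grid point, because the log-price sees the second component only
  through its terminal value. \<open>completed_sigma\<close> takes an arbitrary set of times so that
  finite grids and the full interval are instances of one construction.

  The factor \<open>exp (- (\<sigma>\<^sup>2 * \<rho>\<^sup>2 / 2) * T)\<close> is what remains of
  the drift correction -\<sigma>^2 T/2 after half the conditional variance, \<sigma>^2 (1 -
  \<rho>^2) T/2, is added.\<close>

definition completed_sigma ::
  "'a measure \<Rightarrow> (real \<Rightarrow> 'a \<Rightarrow> 'b::topological_space) \<Rightarrow> real set \<Rightarrow> 'a measure" where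
  "completed_sigma M Y S =
     sigma (space M) ({Y s -` A \<inter> space M | s A. s \<in> S \<and> A \<in> sets borel} \<union> null_sets M)"

text \<open>The shape in which \<open>brownian_motion\<close> states the independence of increments.
  As a class of sets it fits \<open>indep_set\<close> directly and serves as an intersection-stable
  generator.\<close>

definition preimages :: "'a measure \<Rightarrow> ('a \<Rightarrow> 'b::topological_space) \<Rightarrow> 'a set set" where
  "preimages M Y = {Y -` A \<inter> space M | A. A \<in> sets borel}"

lemma completed_filtration_eq: "completed_filtration M Y t = completed_sigma M Y {0..t}"
  by (simp add: completed_filtration_def completed_sigma_def)

lemma completed_sigma_generators:
  "{Y s -` A \<inter> space M | s A. s \<in> S \<and> A \<in> sets borel} \<union> null_sets M \<subseteq> Pow (space M)"
  using sets.sets_into_space by fastforce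

lemma space_completed_sigma [simp]: "space (completed_sigma M Y S) = space M"
  using completed_sigma_generators unfolding completed_sigma_def by (rule space_measure_of)

lemma sets_completed_sigma:
  "sets (completed_sigma M Y S) = sigma_sets (space M)
     ({Y s -` A \<inter> space M | s A. s \<in> S \<and> A \<in> sets borel} \<union> null_sets M)"
  using completed_sigma_generators unfolding completed_sigma_def by (rule sets_measure_of)

lemma sets_completed_sigma_subset:
  assumes "space N = space M" "null_sets M \<subseteq> sets N"
    and "\<And>s. s \<in> S \<Longrightarrow> Y s \<in> borel_measurable N"
  shows "sets (completed_sigma M Y S) \<subseteq> sets N"
proof -
  have "{Y s -` A \<inter> space M | s A. s \<in> S \<and> A \<in> sets borel} \<subseteq> sets N"
    using assms(1) measurable_sets[OF assms(3)] by auto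
  then show ?thesis
    unfolding sets_completed_sigma assms(1)[symmetric]
    using assms(2) by (intro sets.sigma_sets_subset) auto
qed

lemma null_sets_subset_completed_sigma: "null_sets M \<subseteq> sets (completed_sigma M Y S)"
  unfolding sets_completed_sigma by auto

lemma measurable_completed_sigma:
  assumes "s \<in> S"
  shows "Y s \<in> borel_measurable (completed_sigma M Y S)"
proof (rule measurableI)
  fix A :: "'b set" assume "A \<in> sets borel"
  then have "Y s -` A \<inter> space M \<in> {Y s -` A \<inter> space M | s A. s \<in> S \<and> A \<in> sets borel}"
    using assms by blast
  then show "Y s -` A \<inter> space (completed_sigma M Y S) \<in> sets (completed_sigma M Y S)"
    unfolding sets_completed_sigma by auto
qed simp

lemma completed_sigma_mono:
  assumes "S \<subseteq> S'"
  shows "sets (completed_sigma M Y S) \<subseteq> sets (completed_sigma M Y S')"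
  using assms
  by (intro sets_completed_sigma_subset null_sets_subset_completed_sigma measurable_completed_sigma) auto

lemma Int_stable_preimages: "Int_stable (preimages M Y)"
proof (rule Int_stableI)
  fix a b assume "a \<in> preimages M Y" "b \<in> preimages M Y"
  then obtain A B where "a = Y -` A \<inter> space M" "b = Y -` B \<inter> space M" "A \<in> sets borel" "B \<in> sets borel"
    unfolding preimages_def by blast
  then show "a \<inter> b \<in> preimages M Y"
    unfolding preimages_def by (intro CollectI exI[of _ "A \<inter> B"]) auto
qed

lemma space_in_preimages: "space M \<in> preimages M Y"
  unfolding preimages_def by (intro CollectI exI[of _ UNIV]) auto

lemma preimages_subset:
  assumes "space N = space M" "Y \<in> borel_measurable N"
  shows "preimages M Y \<subseteq> sets N"
  using assms(1) measurable_sets[OF assms(2)] unfolding preimages_def by auto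

lemma measurable_preimages:
  assumes "space N = space M" "preimages M Y \<subseteq> sets N"
  shows "Y \<in> borel_measurable N"
proof (rule measurableI)
  fix A :: "'b set" assume "A \<in> sets borel"
  then have "Y -` A \<inter> space M \<in> preimages M Y" unfolding preimages_def by blast
  with assms show "Y -` A \<inter> space N \<in> sets N" by auto
qed simp

lemma vec_nth_measurable [measurable]: "(\<lambda>v :: real ^ 'd. v $ i) \<in> borel_measurable borel"
  by (intro borel_measurable_continuous_onI continuous_intros)

section \<open>Independence of the components of a Brownian motion\<close>

context prob_space
begin

lemma indep_set_mono:
  assumes "indep_set A B" "A' \<subseteq> A" "B' \<subseteq> B"
  shows "indep_set A' B'"
proof (rule indep_setI)
  show "A' \<subseteq> events" "B' \<subseteq> events"
    using assms indep_setD_ev1[OF assms(1)] indep_setD_ev2[OF assms(1)] by blast+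
  show "prob (a \<inter> b) = prob a * prob b" if "a \<in> A'" "b \<in> B'" for a b
    using assms that by (intro indep_setD[OF assms(1)]) auto
qed

text \<open>With $A, C$ read as the past and the increment of one component and $D, E$ as those of
  another, this is the induction step along a time grid.\<close>

lemma indep_set_past_increment:
  assumes stable: "Int_stable A" "Int_stable C" "Int_stable D" "Int_stable E"
    and space: "space M \<in> A" "space M \<in> C" "space M \<in> D" "space M \<in> E"
    and AD: "indep_set A D" and CE: "indep_set C E" and HK: "indep_set H K"
    and H: "\<And>a d. a \<in> A \<Longrightarrow> d \<in> D \<Longrightarrow> a \<inter> d \<in> H"
    and K: "\<And>c e. c \<in> C \<Longrightarrow> e \<in> E \<Longrightarrow> c \<inter> e \<in> K"
  shows "indep_set (sigma_sets (space M) (A \<union> C)) (sigma_sets (space M) (D \<union> E))"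
proof -
  \<comment> \<open>Intersections of one set from each class: a generator of the joint sigma-algebra
    that is stable under intersection, which the union of the two classes is not in general.\<close>
  define I where "I X Y = {x \<inter> y | x y. x \<in> X \<and> y \<in> Y}" for X Y :: "'a set set"
  have events: "A \<subseteq> events" "D \<subseteq> events" "C \<subseteq> events" "E \<subseteq> events"
    using AD CE by (blast dest: indep_setD_ev1 indep_setD_ev2)+
  have into: "x \<inter> space M = x" "space M \<inter> x = x" if "X \<subseteq> events" "x \<in> X" for X x
    using sets.sets_into_space[of x M] that by auto
  have stable_I: "Int_stable (I X Y)" if "Int_stable X" "Int_stable Y" for X Y
  proof (rule Int_stableI)
    fix p q assume "p \<in> I X Y" "q \<in> I X Y"
    then obtain x y x' y' where "p = x \<inter> y" "q = x' \<inter> y'" "x \<in> X" "y \<in> Y" "x' \<in> X" "y' \<in> Y"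
      unfolding I_def by blast
    moreover from this that have "x \<inter> x' \<in> X" "y \<inter> y' \<in> Y"
      unfolding Int_stable_def by blast+
    ultimately show "p \<inter> q \<in> I X Y"
      unfolding I_def by (intro CollectI exI[of _ "x \<inter> x'"] exI[of _ "y \<inter> y'"]) auto
  qed
  have sub: "sigma_sets (space M) (X \<union> Y) \<subseteq> sigma_sets (space M) (I X Y)"
    if "X \<subseteq> events" "Y \<subseteq> events" "space M \<in> X" "space M \<in> Y" for X Y
  proof (rule sigma_sets_mono)
    show "X \<union> Y \<subseteq> sigma_sets (space M) (I X Y)"
    proof
      fix z assume "z \<in> X \<union> Y"
      then have "z \<inter> space M \<in> I X Y \<and> z \<inter> space M = z \<or> space M \<inter> z \<in> I X Y \<and> space M \<inter> z = z"
        unfolding I_def using that(3,4) into(1)[OF that(1)] into(2)[OF that(2)] by blast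
      then have "z \<in> I X Y" by auto
      then show "z \<in> sigma_sets (space M) (I X Y)" by auto
    qed
  qed
  have "indep_set (I A C) (I D E)"
  proof (rule indep_setI)
    show "I A C \<subseteq> events" "I D E \<subseteq> events" using events by (auto simp: I_def)
    fix p q assume "p \<in> I A C" "q \<in> I D E"
    then obtain a c d e where p: "p = a \<inter> c" "a \<in> A" "c \<in> C" and q: "q = d \<inter> e" "d \<in> D" "e \<in> E"
      unfolding I_def by auto
    have HK': "prob ((a \<inter> d) \<inter> (c \<inter> e)) = prob (a \<inter> d) * prob (c \<inter> e)"
      if "a \<in> A" "d \<in> D" "c \<in> C" "e \<in> E" for a d c e
      using indep_setD[OF HK H K] that by blast
    \<comment> \<open>Regrouping by time instead of by component: \<open>a \<inter> d\<close>
      belongs to the past and \<open>c \<inter> e\<close> to the increment, so \<open>HK\<close>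
      separates these two, and \<open>AD\<close> and \<open>CE\<close> then separate the
      components.\<close>
    have "prob (p \<inter> q) = prob ((a \<inter> d) \<inter> (c \<inter> e))"
      unfolding p q by (rule arg_cong[where f=prob]) blast
    also have "\<dots> = (prob a * prob d) * (prob c * prob e)"
      using HK'[of a d c e] p q indep_setD[OF AD, of a d] indep_setD[OF CE, of c e] by simp
    \<comment> \<open>Taking the whole space for \<open>d\<close> and \<open>e\<close> in
      \<open>HK'\<close> recombines past and increment of a single component.\<close>
    also have "prob a * prob c = prob p"
      using HK'[of a "space M" c "space M"] p space events into(1)[of A a] into(1)[of C c] prob_space by simp
    then have "(prob a * prob d) * (prob c * prob e) = prob p * (prob d * prob e)"
      by (metis mult.assoc mult.commute)
    also have "prob d * prob e = prob q"
      using HK'[of "space M" d "space M" e] q space events into(2)[of D d] into(2)[of E e] into(1)[of D d] prob_space by simp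
    finally show "prob (p \<inter> q) = prob p * prob q" .
  qed
  then have "indep_set (sigma_sets (space M) (I A C)) (sigma_sets (space M) (I D E))"
    using stable by (intro indep_set_sigma_sets stable_I)
  then show ?thesis
    by (rule indep_set_mono) (use sub events space in auto)
qed

text \<open>Base of the induction along grids: at time 0 the past is degenerate, and an event of
  probability 0 or 1 is independent of every event.\<close>

lemma indep_set_trivial:
  assumes "\<And>a. a \<in> A \<Longrightarrow> (AE \<omega> in M. \<omega> \<in> a) \<or> (AE \<omega> in M. \<omega> \<notin> a)"
    and ev: "A \<subseteq> events" "B \<subseteq> events"
  shows "indep_set A B"
proof (rule indep_setI[OF ev])
  fix a b assume a: "a \<in> A" and b: "b \<in> B"
  have [measurable]: "a \<in> events" "b \<in> events" using a b ev by auto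
  from assms(1)[OF a] show "prob (a \<inter> b) = prob a * prob b"
  proof
    assume a1: "AE \<omega> in M. \<omega> \<in> a"
    then have "prob (a \<inter> b) = prob b" by (intro finite_measure_eq_AE) auto
    with a1 show ?thesis by (simp add: prob_eq_1)
  next
    assume "AE \<omega> in M. \<omega> \<notin> a"
    then have "prob (a \<inter> b) = prob {}" "prob a = prob {}" by (intro finite_measure_eq_AE; auto)+
    then show ?thesis by simp
  qed
qed

text \<open>The events that are almost surely decided are closed under complements and countable
  unions. Among them are the null sets and every event about an almost surely constant
  variable.\<close>

lemma completed_sigma_AE_const:
  assumes "AE \<omega> in M. Y s \<omega> = c" and "a \<in> sets (completed_sigma M Y {s})"
  shows "(AE \<omega> in M. \<omega> \<in> a) \<or> (AE \<omega> in M. \<omega> \<notin> a)"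
  using assms(2) unfolding sets_completed_sigma
proof induction
  case (Basic a)
  then consider A where "a = Y s -` A \<inter> space M" | "a \<in> null_sets M" by auto
  then show ?case
  proof cases
    case 1
    have "AE \<omega> in M. \<omega> \<in> a \<longleftrightarrow> c \<in> A"
      using assms(1) AE_space unfolding 1 by eventually_elim auto
    then show ?thesis by (cases "c \<in> A") auto
  next
    case 2
    then show ?thesis by (auto dest: AE_not_in)
  qed
next
  case (Compl a)
  from Compl.IH show ?case
  proof
    assume "AE \<omega> in M. \<omega> \<in> a"
    then have "AE \<omega> in M. \<omega> \<notin> space M - a" by eventually_elim auto
    then show ?thesis ..
  next
    assume "AE \<omega> in M. \<omega> \<notin> a"
    then have "AE \<omega> in M. \<omega> \<in> space M - a" using AE_space by eventually_elim auto
    then show ?thesis ..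
  qed
next
  case (Union a)
  show ?case
  proof (cases "\<exists>i. AE \<omega> in M. \<omega> \<in> a i")
    case True
    then obtain i where "AE \<omega> in M. \<omega> \<in> a i" by blast
    then have "AE \<omega> in M. \<omega> \<in> (\<Union>i. a i)" by eventually_elim auto
    then show ?thesis ..
  next
    case False
    with Union.IH have "\<And>i. AE \<omega> in M. \<omega> \<notin> a i" by blast
    then show ?thesis by (simp add: AE_all_countable)
  qed
qed simp

end

section \<open>The path of one Brownian component against the terminal value of another\<close>

context filtered_prob_space
begin

lemma space_F: "t \<in> {0..T} \<Longrightarrow> space (F t) = space M"
  using subalgebra_F by (auto simp: subalgebra_def)

lemma sets_F: "t \<in> {0..T} \<Longrightarrow> sets (F t) \<subseteq> sets M"
  using subalgebra_F by (auto simp: subalgebra_def)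

lemma null_sets_F: "t \<in> {0..T} \<Longrightarrow> null_sets M \<subseteq> sets (F t)"
  using null_sets_F0 F_mono[of 0 t] by auto

lemma measurable_F_mono:
  "Y \<in> measurable (F s) N \<Longrightarrow> 0 \<le> s \<Longrightarrow> s \<le> t \<Longrightarrow> t \<le> T \<Longrightarrow> Y \<in> measurable (F t) N"
  using F_mono[of s t] space_F[of s] space_F[of t] by (auto simp: measurable_def)

lemma measurable_F_M: "Y \<in> measurable (F t) N \<Longrightarrow> t \<in> {0..T} \<Longrightarrow> Y \<in> measurable M N"
  using sets_F[of t] space_F[of t] by (auto simp: measurable_def)

lemma measurable_completed_filtration_M:
  assumes Y: "\<And>s. s \<in> {0..t} \<Longrightarrow> Y s \<in> borel_measurable M"
    and Z: "Z \<in> measurable (completed_filtration M Y t) N"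
  shows "Z \<in> measurable M N"
proof -
  have "sets (completed_filtration M Y t) \<subseteq> sets M"
    unfolding completed_filtration_eq using Y by (intro sets_completed_sigma_subset) auto
  with Z show ?thesis
    by (auto simp: measurable_def completed_filtration_eq)
qed

lemma brownian_component_measurable:
  fixes B :: "real \<Rightarrow> 'a \<Rightarrow> real ^ 'd"
  assumes "brownian_motion M F T B" "t \<in> {0..T}"
  shows "(\<lambda>\<omega>. B t \<omega> $ i) \<in> borel_measurable (F t)"
proof -
  have "B t \<in> borel_measurable (F t)"
    using assms by (auto simp: brownian_motion_def adapted_def)
  then show ?thesis by (rule measurable_compose) (rule vec_nth_measurable)
qed

text \<open>The last value of component \<open>j\<close> suffices to continue the induction, because
  its next value is this one plus an increment; component \<open>i\<close> has to keep its whole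
  past. Time 0 stands apart from \<open>S\<close> so that \<open>Max\<close> always exists and every
  new grid point has a predecessor.\<close>

lemma brownian_components_indep_finite:
  fixes B :: "real \<Rightarrow> 'a \<Rightarrow> real ^ 'd"
  assumes B: "brownian_motion M F T B" and ij: "i \<noteq> j" and T: "0 \<le> T"
    and S: "finite S" "S \<subseteq> {0<..T}"
  shows "indep_set (sets (completed_sigma M (\<lambda>t \<omega>. B t \<omega> $ i) (insert 0 S)))
           (preimages M (\<lambda>\<omega>. B (Max (insert 0 S)) \<omega> $ j))"
  using S
proof (induction rule: finite_linorder_max_induct)
  case empty
  have *: "AE \<omega> in M. B 0 \<omega> $ i = 0" using B by (auto simp: brownian_motion_def)
  have B0: "(\<lambda>\<omega>. B 0 \<omega> $ i) \<in> borel_measurable M" for i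
    using brownian_component_measurable[OF B, of 0] measurable_F_M T by auto
  show ?case
    using completed_sigma_AE_const[of "\<lambda>t \<omega>. B t \<omega> $ i" 0, OF *] B0
    by (intro indep_set_trivial preimages_subset sets_completed_sigma_subset) auto
next
  case (insert b S)
  \<comment> \<open>The induction adds points in increasing order, so \<open>a\<close> is the grid
    point just before \<open>b\<close> and the new information is the increment from
    \<open>a\<close> to \<open>b\<close>.\<close>
  define a where "a = Max (insert 0 S)"
  have a: "a \<in> insert 0 S" unfolding a_def using insert.hyps by (intro Max_in) auto
  have le_a: "s \<le> a" if "s \<in> insert 0 S" for s
    unfolding a_def using insert.hyps that by (intro Max_ge) auto
  have ab: "0 \<le> a" "a < b" "b \<le> T"
    using a insert.hyps insert.prems le_a by auto
  have Max_b: "Max (insert 0 (insert b S)) = b"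
  proof (rule Max_eqI)
    fix s assume "s \<in> insert 0 (insert b S)"
    then show "s \<le> b" using insert.hyps(2) ab by force
  qed (use insert.hyps in auto)
  let ?G = "\<lambda>S. completed_sigma M (\<lambda>t \<omega>. B t \<omega> $ i) S"
  let ?D = "\<lambda>i \<omega>. B b \<omega> $ i - B a \<omega> $ i"
  have Bm: "(\<lambda>\<omega>. B s \<omega> $ i) \<in> borel_measurable (F a)" if "s \<in> insert 0 S" for s i
  proof (rule measurable_F_mono)
    have s: "0 \<le> s" using that insert.prems by auto
    then show "(\<lambda>\<omega>. B s \<omega> $ i) \<in> borel_measurable (F s)"
      using le_a[OF that] ab by (intro brownian_component_measurable[OF B]) auto
    show "0 \<le> s" "s \<le> a" "a \<le> T" using s le_a[OF that] ab by auto
  qed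
  have GF: "sets (?G (insert 0 S)) \<subseteq> sets (F a)"
    using Bm ab space_F[of a] null_sets_F[of a] by (intro sets_completed_sigma_subset) auto
  have PF: "preimages M (\<lambda>\<omega>. B a \<omega> $ j) \<subseteq> sets (F a)"
    using Bm[OF a] ab space_F[of a] by (intro preimages_subset) auto
  \<comment> \<open>The two properties of a Brownian increment: it is independent of the past as a
    vector, and its components are independent of each other.\<close>
  have HK: "indep_set (sets (F a)) (preimages M (\<lambda>\<omega>. B b \<omega> - B a \<omega>))"
    and CE: "indep_vars (\<lambda>_. borel) ?D UNIV"
    using B[unfolded brownian_motion_def, THEN conjunct2, THEN conjunct2, THEN conjunct2, rule_format, OF ab]
    unfolding preimages_def by simp_all
  have "indep_set (sigma_sets (space M) (sets (?G (insert 0 S)) \<union> preimages M (?D i)))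
      (sigma_sets (space M) (preimages M (\<lambda>\<omega>. B a \<omega> $ j) \<union> preimages M (?D j)))"
  proof (rule indep_set_past_increment[OF _ _ _ _ _ _ _ _ _ _ HK])
    show "Int_stable (sets (?G (insert 0 S)))" by (auto intro: Int_stableI)
    show "space M \<in> sets (?G (insert 0 S))" by (metis sets.top space_completed_sigma)
    show "indep_set (sets (?G (insert 0 S))) (preimages M (\<lambda>\<omega>. B a \<omega> $ j))"
      using insert unfolding a_def by auto
    show "indep_set (preimages M (?D i)) (preimages M (?D j))"
    proof (rule indep_setI)
      show "preimages M (?D i) \<subseteq> events" "preimages M (?D j) \<subseteq> events"
        using CE by (intro preimages_subset; simp add: indep_vars_def)+
      fix c e assume ce: "c \<in> preimages M (?D i)" "e \<in> preimages M (?D j)"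
      have "indep_sets (\<lambda>i. preimages M (?D i)) UNIV"
        using CE by (auto simp: indep_vars_def2 preimages_def)
      from indep_setsD[OF this, of "{i, j}" "\<lambda>k. if k = i then c else e"]
      show "prob (c \<inter> e) = prob c * prob e"
        using ij ce by (auto simp: Int_commute)
    qed
    show "x \<inter> d \<in> sets (F a)"
      if "x \<in> sets (?G (insert 0 S))" "d \<in> preimages M (\<lambda>\<omega>. B a \<omega> $ j)" for x d
      using that GF PF by auto
    show "c \<inter> e \<in> preimages M (\<lambda>\<omega>. B b \<omega> - B a \<omega>)"
      if "c \<in> preimages M (?D i)" "e \<in> preimages M (?D j)" for c e
    proof -
      from that obtain U V where UV: "c = ?D i -` U \<inter> space M" "e = ?D j -` V \<inter> space M"
        and [measurable]: "U \<in> sets borel" "V \<in> sets borel"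
        unfolding preimages_def by blast
      \<comment> \<open>A joint event about two components of the increment is a Borel event about
        the vector increment, which is what \<open>HK\<close> speaks of.\<close>
      have "{v :: real ^ 'd. v $ i \<in> U \<and> v $ j \<in> V} \<in> sets borel" by measurable
      moreover have "c \<inter> e = (\<lambda>\<omega>. B b \<omega> - B a \<omega>) -` {v. v $ i \<in> U \<and> v $ j \<in> V} \<inter> space M"
        unfolding UV by auto
      ultimately show ?thesis unfolding preimages_def by blast
    qed
  qed (rule Int_stable_preimages space_in_preimages)+
  then show ?case
  proof (rule indep_set_mono)
    \<comment> \<open>The induction step yields sigma-algebras generated by past and increment;
      adding the two recovers the value at \<open>b\<close>, so the sigma-algebras of the extended
      grid lie inside them.\<close>
    have sum_measurable: "(\<lambda>\<omega>. B b \<omega> $ k) \<in> borel_measurable (sigma (space M) (P \<union> preimages M (?D k)))"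
      if "preimages M (\<lambda>\<omega>. B a \<omega> $ k) \<subseteq> P" "P \<subseteq> Pow (space M)" for P k
    proof -
      have pow: "P \<union> preimages M (?D k) \<subseteq> Pow (space M)" using that by (auto simp: preimages_def)
      have "(\<lambda>\<omega>. B a \<omega> $ k) \<in> borel_measurable (sigma (space M) (P \<union> preimages M (?D k)))"
        "?D k \<in> borel_measurable (sigma (space M) (P \<union> preimages M (?D k)))"
        using that by (intro measurable_preimages; force simp: space_measure_of[OF pow] sets_measure_of[OF pow])+
      then have "(\<lambda>\<omega>. B a \<omega> $ k + ?D k \<omega>) \<in> borel_measurable (sigma (space M) (P \<union> preimages M (?D k)))"
        by (rule borel_measurable_add)
      then show ?thesis by simp
    qed
    let ?N = "sigma (space M) (sets (?G (insert 0 S)) \<union> preimages M (?D i))"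
    let ?N' = "sigma (space M) (preimages M (\<lambda>\<omega>. B a \<omega> $ j) \<union> preimages M (?D j))"
    have pow: "sets (?G (insert 0 S)) \<union> preimages M (?D i) \<subseteq> Pow (space M)"
        "preimages M (\<lambda>\<omega>. B a \<omega> $ j) \<union> preimages M (?D j) \<subseteq> Pow (space M)"
      using sets.space_closed[of "?G (insert 0 S)"] by (auto simp: preimages_def)
    have "sets (?G (insert 0 (insert b S))) \<subseteq> sets ?N"
    proof (rule sets_completed_sigma_subset)
      show "space ?N = space M" using pow(1) by (rule space_measure_of)
      have GN: "sets (?G (insert 0 S)) \<subseteq> sets ?N" using pow by (auto simp: sets_measure_of)
      then show "null_sets M \<subseteq> sets ?N" using null_sets_subset_completed_sigma by blast
      fix s assume s: "s \<in> insert 0 (insert b S)"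
      show "(\<lambda>\<omega>. B s \<omega> $ i) \<in> borel_measurable ?N"
      proof (cases "s = b")
        case True
        have "preimages M (\<lambda>\<omega>. B a \<omega> $ i) \<subseteq> sets (?G (insert 0 S))"
          using measurable_completed_sigma[OF a, of "\<lambda>t \<omega>. B t \<omega> $ i" M]
          by (intro preimages_subset) auto
        then show ?thesis unfolding True using pow by (intro sum_measurable) auto
      next
        case False
        then have "preimages M (\<lambda>\<omega>. B s \<omega> $ i) \<subseteq> sets (?G (insert 0 S))"
          using s measurable_completed_sigma[of s "insert 0 S" "\<lambda>t \<omega>. B t \<omega> $ i" M]
          by (intro preimages_subset) auto
        then show ?thesis using GN space_measure_of[OF pow(1)] by (intro measurable_preimages) auto
      qed
    qed
    then show "sets (?G (insert 0 (insert b S)))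
        \<subseteq> sigma_sets (space M) (sets (?G (insert 0 S)) \<union> preimages M (?D i))"
      using pow by (simp add: sets_measure_of)
    have "preimages M (\<lambda>\<omega>. B b \<omega> $ j) \<subseteq> sets ?N'"
      using pow by (intro preimages_subset sum_measurable) (auto simp: space_measure_of)
    then show "preimages M (\<lambda>\<omega>. B (Max (insert 0 (insert b S))) \<omega> $ j)
        \<subseteq> sigma_sets (space M) (preimages M (\<lambda>\<omega>. B a \<omega> $ j) \<union> preimages M (?D j))"
      unfolding Max_b using pow by (simp add: sets_measure_of)
  qed
qed

text \<open>Each generator of the full completed filtration concerns a single time or is a null set,
  so it belongs to a finite grid. Events of finite grids are closed under intersection because two
  grids can be merged, and independence then passes to the sigma-algebra they generate.\<close>

lemma brownian_components_indep:
  fixes B :: "real \<Rightarrow> 'a \<Rightarrow> real ^ 'd"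
  assumes B: "brownian_motion M F T B" and ij: "i \<noteq> j" and T: "0 \<le> T"
  shows "indep_set (sets (completed_filtration M (\<lambda>t \<omega>. B t \<omega> $ i) T)) (preimages M (\<lambda>\<omega>. B T \<omega> $ j))"
proof -
  let ?G = "\<lambda>S. completed_sigma M (\<lambda>t \<omega>. B t \<omega> $ i) S"
  define \<G> where "\<G> = (\<Union>S\<in>{S. finite S \<and> S \<subseteq> {0..T}}. sets (?G S))"
  have T_pre: "preimages M (\<lambda>\<omega>. B T \<omega> $ j) \<subseteq> events"
    using brownian_component_measurable[OF B, of T] measurable_F_M[of _ T] T by (intro preimages_subset) auto
  have step: "indep_set (sets (?G S)) (preimages M (\<lambda>\<omega>. B T \<omega> $ j))"
    if "finite S" "S \<subseteq> {0..T}" for S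
  proof -
    \<comment> \<open>Adding \<open>T\<close> makes it the last grid point, whatever
      \<open>S\<close> is; 0 is taken out because the finite version inserts it itself.\<close>
    let ?S = "insert T S - {0}"
    have "Max (insert 0 ?S) = T"
      using that T by (intro Max_eqI) (auto split: if_splits)
    moreover have "indep_set (sets (?G (insert 0 ?S))) (preimages M (\<lambda>\<omega>. B (Max (insert 0 ?S)) \<omega> $ j))"
      using that T by (intro brownian_components_indep_finite[OF B ij T]) (auto simp: less_le)
    ultimately show ?thesis
      using completed_sigma_mono[of S "insert 0 ?S" M "\<lambda>t \<omega>. B t \<omega> $ i"]
      by (auto intro: indep_set_mono)
  qed
  have indep: "indep_set \<G> (preimages M (\<lambda>\<omega>. B T \<omega> $ j))"
  proof (rule indep_setI[OF _ T_pre])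
    show "\<G> \<subseteq> events" unfolding \<G>_def using step by (auto dest!: indep_setD_ev1)
    show "prob (a \<inter> b) = prob a * prob b" if "a \<in> \<G>" "b \<in> preimages M (\<lambda>\<omega>. B T \<omega> $ j)" for a b
      using that step unfolding \<G>_def by (auto intro: indep_setD)
  qed
  have "Int_stable \<G>"
  proof (rule Int_stableI)
    fix a b assume "a \<in> \<G>" "b \<in> \<G>"
    then obtain S S' where S: "finite S" "S \<subseteq> {0..T}" "a \<in> sets (?G S)"
        "finite S'" "S' \<subseteq> {0..T}" "b \<in> sets (?G S')"
      unfolding \<G>_def by auto
    then have "a \<in> sets (?G (S \<union> S'))" "b \<in> sets (?G (S \<union> S'))"
      using completed_sigma_mono[of S "S \<union> S'" M "\<lambda>t \<omega>. B t \<omega> $ i"]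
        completed_sigma_mono[of S' "S \<union> S'" M "\<lambda>t \<omega>. B t \<omega> $ i"] by auto
    then show "a \<inter> b \<in> \<G>"
      using S unfolding \<G>_def by (auto intro!: exI[of _ "S \<union> S'"])
  qed
  then have "indep_set (sigma_sets (space M) \<G>) (sigma_sets (space M) (preimages M (\<lambda>\<omega>. B T \<omega> $ j)))"
    by (intro indep_set_sigma_sets indep Int_stable_preimages)
  moreover have "sets (completed_filtration M (\<lambda>t \<omega>. B t \<omega> $ i) T) \<subseteq> sigma_sets (space M) \<G>"
    unfolding completed_filtration_eq sets_completed_sigma[of _ _ "{0..T}"]
  proof (rule sigma_sets_mono, rule subsetI)
    fix x assume "x \<in> {(\<lambda>\<omega>. B s \<omega> $ i) -` A \<inter> space M |s A. s \<in> {0..T} \<and> A \<in> sets borel} \<union> null_sets M"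
    then consider s A where "s \<in> {0..T}" "A \<in> sets borel" "x = (\<lambda>\<omega>. B s \<omega> $ i) -` A \<inter> space M"
      | "x \<in> null_sets M" by blast
    then have "x \<in> \<G>"
    proof cases
      case 1
      then have "x \<in> sets (?G {s})"
        using measurable_sets[OF measurable_completed_sigma[of s "{s}" "\<lambda>t \<omega>. B t \<omega> $ i" M]] by auto
      with 1 show ?thesis unfolding \<G>_def by (auto intro!: exI[of _ "{s}"])
    next
      case 2
      then show ?thesis
        using null_sets_subset_completed_sigma[of M "\<lambda>t \<omega>. B t \<omega> $ i" "{}"]
        unfolding \<G>_def by (auto intro!: exI[of _ "{}"])
    qed
    then show "x \<in> sigma_sets (space M) \<G>" by auto
  qed
  ultimately show ?thesis
    by (rule indep_set_mono) auto
qed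

text \<open>The motion starts at 0 only almost surely, so the law of the value is transferred from
  the increment over \<open>{0..t}\<close>, which agrees with it almost everywhere.\<close>

lemma brownian_marginal:
  fixes B :: "real \<Rightarrow> 'a \<Rightarrow> real ^ 'd"
  assumes B: "brownian_motion M F T B" and t: "0 < t" "t \<le> T"
  shows "distributed M lborel (\<lambda>\<omega>. B t \<omega> $ i) (normal_density 0 (sqrt t))"
proof -
  have incr: "distributed M lborel (\<lambda>\<omega>. B t \<omega> $ i - B 0 \<omega> $ i) (normal_density 0 (sqrt (t - 0)))"
    using B[unfolded brownian_motion_def, THEN conjunct2, THEN conjunct2, THEN conjunct2, rule_format, OF order_refl t]
    by blast
  have Bt: "(\<lambda>\<omega>. B t \<omega> $ i) \<in> borel_measurable M"
    using t measurable_F_M[OF brownian_component_measurable[OF B, of t i]] by auto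
  have "AE \<omega> in M. B 0 \<omega> = 0" using B by (simp add: brownian_motion_def)
  then have "AE \<omega> in M. B t \<omega> $ i = B t \<omega> $ i - B 0 \<omega> $ i" by eventually_elim simp
  then have "distr M lborel (\<lambda>\<omega>. B t \<omega> $ i) = distr M lborel (\<lambda>\<omega>. B t \<omega> $ i - B 0 \<omega> $ i)"
    using Bt incr by (intro distr_cong_AE) (auto simp: distributed_def)
  then show ?thesis
    using incr Bt by (simp add: distributed_def)
qed

end

section \<open>Gaussian integrals\<close>

interpretation std_normal: real_distribution std_normal_distribution
  by (rule real_dist_normal_dist)

lemma std_normal_cdf_measurable [measurable]: "cdf std_normal_distribution \<in> borel_measurable borel"
  by (intro borel_measurable_mono monoI std_normal.cdf_nondecreasing)

text \<open>The reflecting substitution \<open>w = m - s * z\<close> turns the upper tail beyond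
  \<open>h\<close> into a lower tail of the standard Gaussian law, which is what the distribution
  function measures.\<close>

lemma integral_normal_density_greaterThan:
  assumes s: "s > 0"
  shows "(LINT w|lborel. indicator {h<..} w * normal_density m s w) = cdf std_normal_distribution ((m - h) / s)"
proof -
  let ?y = "(m - h) / s"
  have "(LINT w|lborel. indicator {h<..} w * normal_density m s w)
      = s * (LINT z|lborel. indicator {h<..} (m + - s * z) * normal_density m s (m + - s * z))"
    using s by (subst lborel_integral_real_affine[where c="-s" and t=m]) auto
  also have "\<dots> = (LINT z|lborel. indicator {..<?y} z * std_normal_density z)"
    unfolding Bochner_Integration.integral_mult_right_zero[symmetric]
  proof (intro Bochner_Integration.integral_cong refl)
    fix z :: real
    have "h < m - s * z \<longleftrightarrow> z < ?y" using s by (simp add: field_simps)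
    moreover have "s * normal_density m s (m - s * z) = std_normal_density z"
      using s by (simp add: normal_density_def real_sqrt_mult field_simps power2_eq_square)
    ultimately show "s * (indicator {h<..} (m + - s * z) * normal_density m s (m + - s * z))
        = indicator {..<?y} z * std_normal_density z"
      by (auto simp: indicator_def)
  qed
  \<comment> \<open>The distribution function refers to the closed half-line; the endpoint is a null
    set.\<close>
  also have "\<dots> = (LINT z|lborel. std_normal_density z * indicator {..?y} z)"
  proof (intro integral_cong_AE)
    have "AE z in lborel. z \<noteq> ?y" by (rule AE_lborel_singleton)
    then show "AE z in lborel. indicator {..<?y} z * std_normal_density z = std_normal_density z * indicator {..?y} z"
      by eventually_elim (auto simp: indicator_def)
  qed auto
  also have "\<dots> = (LINT z|std_normal_distribution. indicator {..?y} z)"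
    by (subst integral_density) auto
  also have "\<dots> = cdf std_normal_distribution ?y"
    by (simp add: cdf_def)
  finally show ?thesis .
qed

text \<open>Completing the square: exponential tilting of a centred Gaussian moves its mean by
  \<open>c * s\<^sup>2\<close>. This is the one-dimensional Girsanov change of measure, and the
  shift is the origin of the difference between \<open>d1\<close> and \<open>d2\<close>.\<close>

lemma normal_density_exp_shift:
  assumes "s > 0"
  shows "exp (c * w) * normal_density 0 s w = exp (c\<^sup>2 * s\<^sup>2 / 2) * normal_density (c * s\<^sup>2) s w"
proof -
  have "c * w + - w\<^sup>2 / (2 * s\<^sup>2) = c\<^sup>2 * s\<^sup>2 / 2 + - (w - c * s\<^sup>2)\<^sup>2 / (2 * s\<^sup>2)"
    using assms by (simp add: field_simps power2_eq_square)
  then have "exp (c * w) * exp (- w\<^sup>2 / (2 * s\<^sup>2))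
      = exp (c\<^sup>2 * s\<^sup>2 / 2) * exp (- (w - c * s\<^sup>2)\<^sup>2 / (2 * s\<^sup>2))"
    by (simp only: exp_add[symmetric])
  then show ?thesis by (simp add: normal_density_def)
qed

lemma integrable_exp_normal_density:
  assumes "s > 0"
  shows "integrable lborel (\<lambda>w. exp (c * w) * normal_density 0 s w)"
  unfolding normal_density_exp_shift[OF assms] using assms by auto

lemma black_scholes_integral:
  assumes s: "s > 0" and c: "c > 0"
  shows "integrable lborel (\<lambda>w. max (exp (a + c * w) - exp k) 0 * normal_density 0 s w)" (is ?int)
    and "(LINT w|lborel. max (exp (a + c * w) - exp k) 0 * normal_density 0 s w) =
      exp (a + c\<^sup>2 * s\<^sup>2 / 2) * cdf std_normal_distribution ((a - k + c\<^sup>2 * s\<^sup>2) / (c * s))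
      - exp k * cdf std_normal_distribution ((a - k) / (c * s))" (is ?eq)
proof -
  \<comment> \<open>The exercise boundary: the payoff is positive exactly for \<open>w\<close> above
    \<open>?h\<close>. There it is a difference of two terms, one Gaussian tail with tilted mean
    \<open>c * s\<^sup>2\<close> and one with mean 0.\<close>
  let ?h = "(k - a) / c"
  let ?f = "\<lambda>m w. indicator {?h<..} w * normal_density m s w"
  have split: "max (exp (a + c * w) - exp k) 0 * normal_density 0 s w
      = exp (a + c\<^sup>2 * s\<^sup>2 / 2) * ?f (c * s\<^sup>2) w - exp k * ?f 0 w" for w
  proof -
    have "?h < w \<longleftrightarrow> k < a + c * w" using c by (simp add: field_simps)
    then have "max (exp (a + c * w) - exp k) 0 * normal_density 0 s w
      = indicator {?h<..} w * (exp a * (exp (c * w) * normal_density 0 s w) - exp k * normal_density 0 s w)"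
      by (auto simp: indicator_def max_def exp_add[symmetric] algebra_simps mult_exp_exp)
    then show ?thesis
      unfolding normal_density_exp_shift[OF s] by (simp add: exp_add algebra_simps)
  qed
  have int: "integrable lborel (?f m)" for m
    using integrable_mult_indicator[OF _ integrable_normal_density[OF s], of "{?h<..}" m] by simp
  show ?int unfolding split using int by auto
  have "(c * s\<^sup>2 - ?h) / s = (a - k + c\<^sup>2 * s\<^sup>2) / (c * s)" "(0 - ?h) / s = (a - k) / (c * s)"
    using s c by (simp_all add: field_simps power2_eq_square)
  then show ?eq
    unfolding split using int
    by (simp add: Bochner_Integration.integral_diff integral_normal_density_greaterThan[OF s] del: diff_0)
qed

lemma integrable_exp_normal:
  assumes W: "distributed M lborel W (normal_density 0 s)" and s: "0 < s"
  shows "integrable M (\<lambda>\<omega>. exp (c * W \<omega>))"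
  using integrable_exp_normal_density[OF s, of c]
  by (subst distributed_integrable[OF W, symmetric]) (auto simp: mult.commute)

section \<open>Integrating out an independent variable\<close>

text \<open>The library's \<open>indep_var\<close> forces both variables to have the same codomain type.\<close>

lemma (in prob_space) indep_set_distr_pair:
  assumes [measurable]: "Z \<in> measurable M N" "W \<in> measurable M K"
    and indep: "indep_set {Z -` A \<inter> space M | A. A \<in> sets N} {W -` A \<inter> space M | A. A \<in> sets K}"
  shows "distr M N Z \<Otimes>\<^sub>M distr M K W = distr M (N \<Otimes>\<^sub>M K) (\<lambda>\<omega>. (Z \<omega>, W \<omega>))"
proof (rule pair_measure_eqI)
  interpret Z: prob_space "distr M N Z" by (rule prob_space_distr) measurable
  interpret W: prob_space "distr M K W" by (rule prob_space_distr) measurable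
  show "sigma_finite_measure (distr M N Z)" "sigma_finite_measure (distr M K W)"
    by unfold_locales
  fix A C assume "A \<in> sets (distr M N Z)" "C \<in> sets (distr M K W)"
  then have [measurable]: "A \<in> sets N" "C \<in> sets K" by auto
  have "(\<lambda>\<omega>. (Z \<omega>, W \<omega>)) -` (A \<times> C) \<inter> space M = (Z -` A \<inter> space M) \<inter> (W -` C \<inter> space M)"
    by auto
  moreover have "prob ((Z -` A \<inter> space M) \<inter> (W -` C \<inter> space M))
      = prob (Z -` A \<inter> space M) * prob (W -` C \<inter> space M)"
    by (rule indep_setD[OF indep]) auto
  ultimately show "emeasure (distr M N Z) A * emeasure (distr M K W) C
      = emeasure (distr M (N \<Otimes>\<^sub>M K) (\<lambda>\<omega>. (Z \<omega>, W \<omega>))) (A \<times> C)"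
    by (simp add: emeasure_distr emeasure_eq_measure ennreal_mult')
qed simp

text \<open>Takes the place of conditioning on \<open>Z\<close>: by independence the law of the pair
  is a product, and Tonelli's theorem for the nonnegative \<open>f\<close> integrates
  \<open>W\<close> out with \<open>Z\<close> frozen.\<close>

lemma (in prob_space) expectation_indep_density:
  fixes W :: "'a \<Rightarrow> 'b::euclidean_space"
  assumes Z [measurable]: "Z \<in> measurable M N"
    and indep: "indep_set {Z -` A \<inter> space M | A. A \<in> sets N} {W -` A \<inter> space M | A. A \<in> sets borel}"
    and W: "distributed M lborel W (\<lambda>w. ennreal (D w))"
    and D [measurable]: "D \<in> borel_measurable borel" "\<And>w. 0 \<le> D w"
    and f [measurable]: "f \<in> borel_measurable (N \<Otimes>\<^sub>M borel)" and f_nonneg: "\<And>x. 0 \<le> f x"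
    and int: "\<And>z. integrable lborel (\<lambda>w. f (z, w) * D w)"
  shows "expectation (\<lambda>\<omega>. f (Z \<omega>, W \<omega>)) = expectation (\<lambda>\<omega>. LINT w|lborel. f (Z \<omega>, w) * D w)"
proof -
  have [measurable]: "W \<in> borel_measurable M" using distributed_measurable[OF W] by simp
  interpret W: prob_space "distr M borel W" by (rule prob_space_distr) measurable
  let ?g = "\<lambda>z. LINT w|lborel. f (z, w) * D w"
  have [measurable]: "?g \<in> borel_measurable N" by measurable
  have W_density: "distr M borel W = density lborel (\<lambda>w. ennreal (D w))"
    using distributed_distr_eq_density[OF W] by (simp cong: distr_cong)
  have "(\<integral>\<^sup>+\<omega>. ennreal (f (Z \<omega>, W \<omega>)) \<partial>M)
      = (\<integral>\<^sup>+x. ennreal (f x) \<partial>distr M (N \<Otimes>\<^sub>M borel) (\<lambda>\<omega>. (Z \<omega>, W \<omega>)))"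
    by (subst nn_integral_distr) auto
  also have "\<dots> = (\<integral>\<^sup>+x. ennreal (f x) \<partial>(distr M N Z \<Otimes>\<^sub>M distr M borel W))"
    using indep by (subst indep_set_distr_pair) auto
  also have "\<dots> = (\<integral>\<^sup>+z. \<integral>\<^sup>+w. ennreal (f (z, w)) \<partial>distr M borel W \<partial>distr M N Z)"
    by (rule W.nn_integral_fst[symmetric]) simp
  also have "\<dots> = (\<integral>\<^sup>+z. ennreal (?g z) \<partial>distr M N Z)"
  proof (intro nn_integral_cong)
    fix z assume "z \<in> space (distr M N Z)"
    then have [measurable]: "(\<lambda>w. f (z, w)) \<in> borel_measurable borel" by simp
    have "(\<integral>\<^sup>+w. ennreal (f (z, w)) \<partial>distr M borel W) = (\<integral>\<^sup>+w. ennreal (f (z, w) * D w) \<partial>lborel)"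
      unfolding W_density using D f_nonneg
      by (subst nn_integral_density) (auto simp: ennreal_mult' mult.commute)
    also have "\<dots> = ennreal (?g z)"
      using int D f_nonneg by (intro nn_integral_eq_integral) auto
    finally show "(\<integral>\<^sup>+w. ennreal (f (z, w)) \<partial>distr M borel W) = ennreal (?g z)" .
  qed
  also have "\<dots> = (\<integral>\<^sup>+\<omega>. ennreal (?g (Z \<omega>)) \<partial>M)"
    by (rule nn_integral_distr) auto
  \<comment> \<open>Both expectations are real values of nonnegative integrals just shown to be
    equal, so the identity passes to them by \<open>enn2real\<close>.\<close>
  finally show ?thesis
    using f_nonneg D by (subst (1 2) integral_eq_nn_integral) auto
qed

section \<open>The integrated rate\<close>

text \<open>Preimages under \<open>f\<close> and \<open>g\<close> differ by a subset of a null set,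
  which completeness makes measurable.\<close>

lemma (in complete_measure) borel_measurable_AE_eq:
  assumes f: "f \<in> borel_measurable M" and eq: "AE \<omega> in M. f \<omega> = g \<omega>"
  shows "g \<in> borel_measurable M"
proof (rule measurableI)
  fix A :: "'b set" assume A: "A \<in> sets borel"
  have "AE \<omega> in M. \<omega> \<in> f -` A \<inter> space M \<longleftrightarrow> \<omega> \<in> g -` A \<inter> space M"
    using eq by eventually_elim auto
  then show "g -` A \<inter> space M \<in> sets M"
    using measurable_sets[OF f A] by (rule in_sets_AE) auto
qed simp

text \<open>These are the grid points of mesh \<open>1 / Suc n\<close> just below \<open>s\<close>.
  For each \<open>n\<close> they take countably many values, which makes sampling a process at them
  jointly measurable.\<close>

lemma floor_mult_divide_tendsto:
  "(\<lambda>n. of_int \<lfloor>real (Suc n) * s\<rfloor> / real (Suc n)) \<longlonglongrightarrow> s"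
proof (rule real_tendsto_sandwich)
  show "(\<lambda>n. s - inverse (real (Suc n))) \<longlonglongrightarrow> s"
    using tendsto_diff[OF tendsto_const LIMSEQ_inverse_real_of_nat, of s] by simp
  show "\<forall>\<^sub>F n in sequentially. s - inverse (real (Suc n)) \<le> of_int \<lfloor>real (Suc n) * s\<rfloor> / real (Suc n)"
  proof (intro always_eventually allI)
    fix n
    have "(s - inverse (real (Suc n))) * real (Suc n) = real (Suc n) * s - 1"
      by (simp add: field_simps del: of_nat_Suc)
    also have "\<dots> \<le> of_int \<lfloor>real (Suc n) * s\<rfloor>"
      using real_of_int_floor_gt_diff_one[of "real (Suc n) * s"] by linarith
    finally show "s - inverse (real (Suc n)) \<le> of_int \<lfloor>real (Suc n) * s\<rfloor> / real (Suc n)"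
      by (simp add: pos_le_divide_eq del: of_nat_Suc)
  qed
  show "\<forall>\<^sub>F n in sequentially. of_int \<lfloor>real (Suc n) * s\<rfloor> / real (Suc n) \<le> s"
    by (intro always_eventually allI)
      (simp add: pos_divide_le_eq mult.commute del: of_nat_Suc)
qed simp

text \<open>Measurability of each \<open>r s\<close> alone does not make the time integral
  measurable. The path is therefore rebuilt as a limit of its samples on ever finer grids: the limit
  is jointly measurable everywhere and equals \<open>r\<close> wherever the path is
  continuous.\<close>

lemma integrated_rate_version:
  assumes T: "0 \<le> T" and r: "\<And>s. s \<in> {0..T} \<Longrightarrow> r s \<in> borel_measurable G"
    and cont: "continuous_paths M T r"
  obtains L where "L \<in> borel_measurable G" "AE \<omega> in M. L \<omega> = integrated_rate T r \<omega>"
proof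
  \<comment> \<open>Keeps every sampling time inside \<open>{0..T}\<close>, where \<open>r\<close>
    is known to be measurable, although joint measurability is shown for all real
    \<open>s\<close>.\<close>
  define clamp where "clamp u = max 0 (min T u)" for u
  define q where "q n s = clamp (of_int \<lfloor>real (Suc n) * s\<rfloor> / real (Suc n))" for n s
  have clamp: "clamp u \<in> {0..T}" for u using T by (auto simp: clamp_def)
  have q: "(\<lambda>n. q n s) \<longlonglongrightarrow> s" if "s \<in> {0..T}" for s
  proof -
    have "(\<lambda>n. q n s) \<longlonglongrightarrow> clamp s"
      unfolding q_def clamp_def by (intro tendsto_max tendsto_min tendsto_const floor_mult_divide_tendsto)
    then show ?thesis using that by (simp add: clamp_def)
  qed
  \<comment> \<open>On paths whose samples diverge, \<open>lim\<close> still has a fixed default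
    value, so \<open>?R\<close> is total and measurable; such paths lie in the exceptional null set
    when \<open>s\<close> is in \<open>{0..T}\<close>.\<close>
  let ?R = "\<lambda>\<omega> s. lim (\<lambda>n. r (q n s) \<omega>)"
  \<comment> \<open>For a fixed value \<open>k\<close> of the floor the sampling time is fixed, so
    the measurability of a single \<open>r s\<close> is enough; the countably many cases are then
    glued.\<close>
  have q_meas: "(\<lambda>x. r (q n (snd x)) (fst x)) \<in> borel_measurable (G \<Otimes>\<^sub>M lborel)" for n
    unfolding q_def
  proof (rule measurable_compose_countable[where
      f="\<lambda>k x. r (clamp (of_int k / real (Suc n))) (fst x)" and g="\<lambda>x. \<lfloor>real (Suc n) * snd x\<rfloor>"])
    show "(\<lambda>x. r (clamp (of_int k / real (Suc n))) (fst x)) \<in> borel_measurable (G \<Otimes>\<^sub>M lborel)" for k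
      using r[OF clamp] by (rule measurable_compose[OF measurable_fst])
    show "(\<lambda>x. \<lfloor>real (Suc n) * snd x\<rfloor>) \<in> G \<Otimes>\<^sub>M lborel \<rightarrow>\<^sub>M count_space UNIV"
      by measurable
  qed
  then have "(\<lambda>x. ?R (fst x) (snd x)) \<in> borel_measurable (G \<Otimes>\<^sub>M lborel)"
    by (rule borel_measurable_lim_metric)
  then have "(\<lambda>(\<omega>, s). indicator {0..T} s *\<^sub>R ?R \<omega> s) \<in> borel_measurable (G \<Otimes>\<^sub>M lborel)"
    unfolding case_prod_beta by (rule borel_measurable_scaleR[rotated]) measurable
  then show "(\<lambda>\<omega>. LINT s:{0..T}|lborel. ?R \<omega> s) \<in> borel_measurable G"
    unfolding set_lebesgue_integral_def by (rule lborel.borel_measurable_lebesgue_integral)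
  show "AE \<omega> in M. (LINT s:{0..T}|lborel. ?R \<omega> s) = integrated_rate T r \<omega>"
    using cont unfolding continuous_paths_def
  proof eventually_elim
    case (elim \<omega>)
    have "?R \<omega> s = r s \<omega>" if "s \<in> {0..T}" for s
      using clamp elim q[OF that] that unfolding q_def
      by (intro limI continuous_on_tendsto_compose[OF elim]) auto
    then show ?case
      unfolding integrated_rate_def by (intro set_lebesgue_integral_cong) auto
  qed
qed

text \<open>Dominated convergence style bound: a continuous path is integrable on the compact
  interval, so its integral is at most that of its absolute value.\<close>

lemma integrable_exp_integrated_rate:
  assumes cont: "continuous_paths M T r" and meas: "integrated_rate T r \<in> borel_measurable M"
    and int: "integrable M (\<lambda>\<omega>. exp (LINT s:{0..T}|lborel. \<bar>r s \<omega>\<bar>))"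
  shows "integrable M (\<lambda>\<omega>. exp (- integrated_rate T r \<omega>))"
proof (rule Bochner_Integration.integrable_bound[OF int])
  show "AE \<omega> in M. norm (exp (- integrated_rate T r \<omega>)) \<le> norm (exp (LINT s:{0..T}|lborel. \<bar>r s \<omega>\<bar>))"
    using cont unfolding continuous_paths_def
  proof eventually_elim
    case (elim \<omega>)
    then have "\<bar>integrated_rate T r \<omega>\<bar> \<le> (LINT s:{0..T}|lborel. \<bar>r s \<omega>\<bar>)"
      unfolding integrated_rate_def
      using set_integral_norm_bound[OF borel_integrable_atLeastAtMost'[OF elim]] by simp
    then show ?case by simp
  qed
qed (use meas in measurable)

section \<open>The call price\<close>

theorem mainTheorem1:
  fixes M :: "'a measure" and F :: "real \<Rightarrow> 'a measure"
    and B :: "real \<Rightarrow> 'a \<Rightarrow> real ^ 2"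
    and \<mu> \<eta> :: "real \<Rightarrow> real \<Rightarrow> real"
    and X r :: "real \<Rightarrow> 'a \<Rightarrow> real"
    and T \<sigma> \<rho> \<kappa> x\<^sub>0 r\<^sub>0 :: real
  assumes "T > 0" and "\<sigma> > 0" and "\<rho> \<in> {-1<..<1}"
    and "filtered_prob_space M F T"
    and "brownian_motion M F T B"
    and "unique_strong_solution M F T B \<mu> \<eta> \<sigma> \<rho> x\<^sub>0 r\<^sub>0 X r"
    and "integrable M (\<lambda>\<omega>. exp (X T \<omega>))"
    and "integrable M (\<lambda>\<omega>. exp (LINT s:{0..T}|lborel. \<bar>r s \<omega>\<bar>))"
  shows "call_price M T \<kappa> X r =
     exp x\<^sub>0 * exp (- (\<sigma>\<^sup>2 * \<rho>\<^sup>2 / 2) * T) *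
       (LINT \<omega>|M. exp (\<sigma> * \<rho> * B T \<omega> $ 1) *
          cdf std_normal_distribution (d1 \<sigma> \<rho> \<kappa> x\<^sub>0 T (integrated_rate T r \<omega>) (B T \<omega> $ 1)))
     - exp \<kappa> *
       (LINT \<omega>|M. exp (- integrated_rate T r \<omega>) *
          cdf std_normal_distribution (d2 \<sigma> \<rho> \<kappa> x\<^sub>0 T (integrated_rate T r \<omega>) (B T \<omega> $ 1)))"
proof -
  interpret filtered_prob_space M F T by fact
  note B = \<open>brownian_motion M F T B\<close>
  have T: "0 < T" "0 \<le> T" using \<open>T > 0\<close> by auto
  have sol: "strong_solution M F T B \<mu> \<eta> \<sigma> \<rho> x\<^sub>0 r\<^sub>0 X r"
    using assms by (simp add: unique_strong_solution_def)
  have rho: "\<rho>\<^sup>2 < 1" using \<open>\<rho> \<in> {-1<..<1}\<close> by (auto simp: abs_square_less_1)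
  define c where "c = \<sigma> * sqrt (1 - \<rho>\<^sup>2)"
  have c: "0 < c" "c\<^sup>2 = \<sigma>\<^sup>2 * (1 - \<rho>\<^sup>2)"
    using rho \<open>\<sigma> > 0\<close> by (auto simp: c_def power_mult_distrib)
  let ?b = "\<lambda>\<omega>. B T \<omega> $ 1" and ?w = "\<lambda>\<omega>. B T \<omega> $ 2" and ?\<Lambda> = "integrated_rate T r"
  let ?G = "completed_filtration M (\<lambda>t \<omega>. B t \<omega> $ 1) T"
  have [measurable]: "?b \<in> borel_measurable M" "?w \<in> borel_measurable M"
    using measurable_F_M[OF brownian_component_measurable[OF B, of T]] T by auto
  have cont: "continuous_paths M T r" using sol by (simp add: strong_solution_def)
  have "r s \<in> borel_measurable ?G" if "s \<in> {0..T}" for s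
  proof -
    have "r s \<in> borel_measurable (completed_filtration M (\<lambda>t \<omega>. B t \<omega> $ 1) s)"
      using sol that by (auto simp: strong_solution_def adapted_def)
    moreover have "sets (completed_filtration M (\<lambda>t \<omega>. B t \<omega> $ 1) s) \<subseteq> sets ?G"
      unfolding completed_filtration_eq using that by (intro completed_sigma_mono) auto
    ultimately show ?thesis by (auto simp: measurable_def completed_filtration_eq)
  qed
  \<comment> \<open>Independence is applied to \<open>L\<close>, which is measurable for the
    sigma-algebra of the first component. The integrated rate itself is only shown to be measurable
    for \<open>M\<close>, by completeness.\<close>
  then obtain L where LG: "L \<in> borel_measurable ?G" and L: "AE \<omega> in M. L \<omega> = ?\<Lambda> \<omega>"
    using integrated_rate_version[OF T(2) _ cont] by blast
  have bG: "?b \<in> borel_measurable ?G"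
    using measurable_completed_sigma[of T "{0..T}" "\<lambda>t \<omega>. B t \<omega> $ 1" M] T
    by (simp add: completed_filtration_eq)
  have [measurable]: "L \<in> borel_measurable M"
    using measurable_F_M[OF brownian_component_measurable[OF B]]
    by (intro measurable_completed_filtration_M[OF _ LG]) auto
  have \<Lambda> [measurable]: "?\<Lambda> \<in> borel_measurable M"
    using borel_measurable_AE_eq[OF _ L] by simp
  \<comment> \<open>Integrability of \<open>exp (X T)\<close> includes its measurability, and
    \<open>ln\<close> undoes the exponential.\<close>
  have "(\<lambda>\<omega>. ln (exp (X T \<omega>))) \<in> borel_measurable M"
    using borel_measurable_integrable[OF assms(7)] by measurable
  then have [measurable]: "X T \<in> borel_measurable M" by simp
  have X: "AE \<omega> in M. X T \<omega> = x\<^sub>0 + ?\<Lambda> \<omega> - \<sigma>\<^sup>2 / 2 * T + \<sigma> * \<rho> * ?b \<omega> + c * ?w \<omega>"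
  proof -
    have "AE \<omega> in M. \<forall>s\<in>{0..T}. X s \<omega> = x\<^sub>0 + (LINT v:{0..s}|lborel. r v \<omega> - \<sigma>\<^sup>2 / 2)
          + \<sigma> * (\<rho> * B s \<omega> $ 1 + sqrt (1 - \<rho>\<^sup>2) * B s \<omega> $ 2)"
      using sol by (simp add: strong_solution_def)
    then show ?thesis
      using cont[unfolded continuous_paths_def]
    proof eventually_elim
      case (elim \<omega>)
      have "(LINT v:{0..T}|lborel. r v \<omega> - \<sigma>\<^sup>2 / 2) = ?\<Lambda> \<omega> - (LINT v:{0..T}|lborel. \<sigma>\<^sup>2 / 2)"
        unfolding integrated_rate_def
        by (intro set_integral_diff borel_integrable_atLeastAtMost' elim continuous_on_const)
      also have "(LINT v:{0..T}|lborel. \<sigma>\<^sup>2 / 2) = \<sigma>\<^sup>2 / 2 * T"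
        using T by (simp add: set_lebesgue_integral_def)
      finally show ?case
        using elim(1) T by (auto simp: c_def algebra_simps)
    qed
  qed
  \<comment> \<open>Discounting cancels the integrated rate in the log-price and moves it into the
    strike. Hence \<open>a\<close> depends on \<open>b\<close> alone, and \<open>l\<close> occurs in
    \<open>payoff\<close> only next to \<open>\<kappa>\<close>.\<close>
  define a where "a b = x\<^sub>0 - \<sigma>\<^sup>2 / 2 * T + \<sigma> * \<rho> * b" for b
  define payoff where "payoff = (\<lambda>((l, b), w). max (exp (a b + c * w) - exp (\<kappa> - l)) 0)"
  have payoff_meas: "payoff \<in> borel_measurable ((borel \<Otimes>\<^sub>M borel) \<Otimes>\<^sub>M borel)"
    unfolding payoff_def a_def case_prod_beta by measurable
  have [measurable]: "a \<in> borel_measurable borel" unfolding a_def by measurable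
  let ?N = "cdf std_normal_distribution"
  let ?d1 = "\<lambda>l b. d1 \<sigma> \<rho> \<kappa> x\<^sub>0 T l b" and ?d2 = "\<lambda>l b. d2 \<sigma> \<rho> \<kappa> x\<^sub>0 T l b"
  let ?K = "exp x\<^sub>0 * exp (- (\<sigma>\<^sup>2 * \<rho>\<^sup>2 / 2) * T)"
  have [measurable]: "(\<lambda>\<omega>. ?d1 (l \<omega>) (b \<omega>)) \<in> borel_measurable M" "(\<lambda>\<omega>. ?d2 (l \<omega>) (b \<omega>)) \<in> borel_measurable M"
    if [measurable]: "l \<in> borel_measurable M" "b \<in> borel_measurable M" for l b
    unfolding d1_def d2_def by measurable
  have inner: "(LINT w|lborel. payoff ((l, b), w) * normal_density 0 (sqrt T) w)
      = ?K * (exp (\<sigma> * \<rho> * b) * ?N (?d1 l b)) - exp \<kappa> * (exp (- l) * ?N (?d2 l b))" for l b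
  proof -
    \<comment> \<open>With \<open>c\<^sup>2 = \<sigma>\<^sup>2 * (1 - \<rho>\<^sup>2)\<close>, half
      the variance cancels the drift correction up to -\<sigma>^2 \<rho>^2 T/2. The full variance
      added in the next step gives the numerator of \<open>d1\<close>.\<close>
    have "exp (a b + c\<^sup>2 * (sqrt T)\<^sup>2 / 2) = ?K * exp (\<sigma> * \<rho> * b)"
      using T unfolding c(2) a_def exp_add[symmetric] by (intro arg_cong[where f=exp]) (simp add: field_simps)
    moreover have "(a b - (\<kappa> - l) + c\<^sup>2 * (sqrt T)\<^sup>2) / (c * sqrt T) = ?d1 l b"
      using T unfolding c(2) unfolding a_def d1_def c_def by (simp add: algebra_simps)
    moreover have "(a b - (\<kappa> - l)) / (c * sqrt T) = ?d2 l b"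
      unfolding a_def d2_def c_def by (simp add: algebra_simps)
    moreover have "exp (\<kappa> - l) = exp \<kappa> * exp (- l)" by (simp add: exp_add[symmetric])
    ultimately show ?thesis
      using black_scholes_integral(2)[of "sqrt T" c "a b" "\<kappa> - l"] T c by (simp add: payoff_def mult.assoc)
  qed
  have "call_price M T \<kappa> X r = expectation (\<lambda>\<omega>. payoff ((L \<omega>, ?b \<omega>), ?w \<omega>))"
    unfolding call_price_def
  proof (rule integral_cong_AE)
    show "AE \<omega> in M. exp (- ?\<Lambda> \<omega>) * max (exp (X T \<omega>) - exp \<kappa>) 0 = payoff ((L \<omega>, ?b \<omega>), ?w \<omega>)"
      using X L
    proof eventually_elim
      case (elim \<omega>)
      have "exp (- ?\<Lambda> \<omega>) * max (exp (X T \<omega>) - exp \<kappa>) 0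
          = max (exp (- ?\<Lambda> \<omega>) * (exp (X T \<omega>) - exp \<kappa>)) 0"
        by (simp add: max_mult_distrib_left)
      also have "exp (- ?\<Lambda> \<omega>) * (exp (X T \<omega>) - exp \<kappa>) = exp (X T \<omega> - ?\<Lambda> \<omega>) - exp (\<kappa> - ?\<Lambda> \<omega>)"
        by (simp add: right_diff_distrib exp_add[symmetric])
      also have "X T \<omega> - ?\<Lambda> \<omega> = a (?b \<omega>) + c * ?w \<omega>"
        using elim(1) by (simp add: a_def)
      finally show ?case
        using elim(2) by (simp add: payoff_def)
    qed
    show "(\<lambda>\<omega>. payoff ((L \<omega>, ?b \<omega>), ?w \<omega>)) \<in> borel_measurable M"
      by (rule measurable_compose[OF _ payoff_meas]) measurable
  qed measurable
  also have "\<dots> = expectation (\<lambda>\<omega>. LINT w|lborel. payoff ((L \<omega>, ?b \<omega>), w) * normal_density 0 (sqrt T) w)"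
  proof (rule expectation_indep_density[where f=payoff and Z="\<lambda>\<omega>. (L \<omega>, ?b \<omega>)"])
    have Z: "(\<lambda>\<omega>. (L \<omega>, ?b \<omega>)) \<in> measurable ?G (borel \<Otimes>\<^sub>M borel)"
      using LG bG by (rule measurable_Pair)
    have "indep_set (sets ?G) (preimages M ?w)"
      using T by (intro brownian_components_indep[OF B]) auto
    then show "indep_set {(\<lambda>\<omega>. (L \<omega>, ?b \<omega>)) -` A \<inter> space M | A. A \<in> sets (borel \<Otimes>\<^sub>M borel)}
        {?w -` A \<inter> space M | A. A \<in> sets borel}"
      unfolding preimages_def
      by (rule indep_set_mono) (use measurable_sets[OF Z] in \<open>auto simp: completed_filtration_eq\<close>)
    show "distributed M lborel ?w (normal_density 0 (sqrt T))"
      using T by (intro brownian_marginal[OF B]) auto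
    show "0 \<le> payoff x" for x by (auto simp: payoff_def split: prod.split)
    show "integrable lborel (\<lambda>w. payoff (z, w) * normal_density 0 (sqrt T) w)" for z
      using black_scholes_integral(1)[of "sqrt T" c] T c by (cases z) (simp add: payoff_def)
  qed (use payoff_meas in auto)
  \<comment> \<open>With the second component integrated out, \<open>L\<close> can be exchanged for
    the integrated rate again, as they agree almost everywhere.\<close>
  also have "\<dots> = expectation (\<lambda>\<omega>. ?K * (exp (\<sigma> * \<rho> * ?b \<omega>) * ?N (?d1 (?\<Lambda> \<omega>) (?b \<omega>)))
      - exp \<kappa> * (exp (- ?\<Lambda> \<omega>) * ?N (?d2 (?\<Lambda> \<omega>) (?b \<omega>))))"
    unfolding inner by (rule integral_cong_AE) (use L in \<open>auto elim!: eventually_mono\<close>)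
  also have "\<dots> = ?K * expectation (\<lambda>\<omega>. exp (\<sigma> * \<rho> * ?b \<omega>) * ?N (?d1 (?\<Lambda> \<omega>) (?b \<omega>)))
      - exp \<kappa> * expectation (\<lambda>\<omega>. exp (- ?\<Lambda> \<omega>) * ?N (?d2 (?\<Lambda> \<omega>) (?b \<omega>)))"
  proof -
    \<comment> \<open>Separating the two expectations requires both to be finite. Since the
      distribution function is at most 1, they are dominated by the exponential moments of the first
      component and of the negative integrated rate.\<close>
    have bounded: "integrable M (\<lambda>\<omega>. f \<omega> * ?N (g \<omega>))"
      if "integrable M f" "g \<in> borel_measurable M" for f g
    proof (rule Bochner_Integration.integrable_bound[OF that(1)])
      show "(\<lambda>\<omega>. f \<omega> * ?N (g \<omega>)) \<in> borel_measurable M"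
        using that borel_measurable_integrable[OF that(1)] by measurable
      show "AE \<omega> in M. norm (f \<omega> * ?N (g \<omega>)) \<le> norm (f \<omega>)"
        by (auto simp: abs_mult cdf_def intro!: mult_left_le std_normal.prob_le_1)
    qed
    have "integrable M (\<lambda>\<omega>. exp (\<sigma> * \<rho> * ?b \<omega>) * ?N (?d1 (?\<Lambda> \<omega>) (?b \<omega>)))"
      using T by (intro bounded integrable_exp_normal[OF brownian_marginal[OF B]]) auto
    moreover have "integrable M (\<lambda>\<omega>. exp (- ?\<Lambda> \<omega>) * ?N (?d2 (?\<Lambda> \<omega>) (?b \<omega>)))"
      by (intro bounded integrable_exp_integrated_rate[OF cont \<Lambda> assms(8)]) auto
    ultimately show ?thesis by simp
  qed
  finally show ?thesis .
qed

end
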